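(* Let $\mathcal{S}\subset\omega_4$ be a Segre variety $\mathcal{S}_3(2)$ and $\mathcal{F}$ a fan for $\mathcal{S}$. (i) $\mathcal{F}$ can be expressed uniquely as a union $\mathcal{F}=t\cup t'\cup t''$ of a triplet of troikas. (ii) The three troikas $t,t',t''$ have the same centre, denoted $c_{\mathcal{F}}$. (iii) $\mathcal{F}$ determines uniquely a triplet $\mathcal{T}=\{\mathcal{F},\mathcal{F}',\mathcal{F}''\}$ of fans of $\mathcal{S}$ such that $\mathcal{F}\cup\mathcal{F}'\cup\mathcal{F}''=\mathcal{S}$; moreover $L(\mathcal{T}):=\{c_{\mathcal{F}},c_{\mathcal{F}'},c_{\mathcal{F}''}\}$ is one of the four lines $\mathbb{P}V_a,\mathbb{P}V_b,\mathbb{P}V_c,\mathbb{P}V_d$.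
   Context: Work over $\mathbb{F}_2$. $V_8=V(8,2)$ with basis $e_1,\dots,e_8$, $V_a=\langle e_1,e_8\rangle$, $V_b=\langle e_2,e_7\rangle$, $V_c=\langle e_3,e_6\rangle$, $V_d=\langle e_4,e_5\rangle$; points of $\operatorname{PG}(7,2)$ are nonzero vectors; $\omega_4$ is the set of vectors all four of whose components in $V_a,\dots,V_d$ are nonzero. Let $\zeta_a: e_1\mapsto e_8\mapsto e_1+e_8\mapsto e_1$, $\zeta_b: e_7\mapsto e_2\mapsto e_2+e_7\mapsto e_7$, $\zeta_c: e_3\mapsto e_6\mapsto e_3+e_6\mapsto e_3$, $\zeta_d: e_5\mapsto e_4\mapsto e_4+e_5\mapsto e_5$; for $\lambda=ijkl\in\mathbb{F}_3^4$, $A_\lambda=\zeta_a^i\oplus\zeta_b^j\oplus\zeta_c^k\oplus\zeta_d^l$; $u=e_1+\dots+e_8$; $p_\lambda=A_\lambda u$, so $\lambda\mapsto p_\lambda$ is a bijection $\mathbb{F}_3^4\to\omega_4$. A Segre variety $\mathcal{S}_3(2)$ is the image under a linear isomorphism $\phi:V(2,2)^{\otimes3}\to V_8$ of the nonzero pure tensors; its generators are the $27$ lines obtained by letting one tensor factor vary over the nonzero vectors with the other two fixed. A fan of $\mathcal{S}$ is a $9$-subset of $\mathcal{S}$ no two of whose points lie on a common generator. The Hamming distance of points of $\omega_4$ is $\operatorname{hd}(p_\rho,p_\sigma)=\operatorname{wt}_\Xi(\rho-\sigma)$, the number of nonzero coordinates of $\rho-\sigma$ in the basis $\{\beta,\gamma,\delta,\alpha\}=\{1221,2121,2211,1111\}$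 of $\mathbb{F}_3^4$. A troika on $\mathcal{S}$ is a set of three points of $\mathcal{S}$ pairwise at Hamming distance $3$; its centre is the vector sum $c(t)=p_1+p_2+p_3$. *)

theory Defs
  imports "HOL-Analysis.Analysis" "HOL-Library.Z2" "HOL-Library.Numeral_Type"
begin

text \<open>
  \<open>\<bbbF>\<^sub>2\<close> is the type \<open>bit\<close>; \<open>V\<^sub>8\<close> is \<open>bit ^ 8\<close>; points of \<open>PG(7,2)\<close> are the nonzero vectors.
  \<open>\<bbbF>\<^sub>3\<close> is the residue ring \<open>3\<close> of \<open>Numeral_Type\<close>. As numerals are residues, the
  index \<open>8 :: 8\<close> is \<open>0\<close>, and likewise \<open>4 :: 4\<close>: coordinates are labelled
  \<open>1, \<dots>, 8\<close> and \<open>1, \<dots>, 4\<close>, all distinct.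
\<close>

definition basis_vec :: "8 \<Rightarrow> bit ^ 8" where
  "basis_vec m = axis m 1"

text \<open>The component of \<open>v\<close> in \<open>\<langle>e\<^sub>m, e\<^sub>n\<rangle>\<close>.\<close>

definition component :: "8 \<Rightarrow> 8 \<Rightarrow> bit ^ 8 \<Rightarrow> bit ^ 8" where
  "component m n v = v $ m *s basis_vec m + v $ n *s basis_vec n"

definition omega4 :: "(bit ^ 8) set" where
  "omega4 = {v. component 1 8 v \<noteq> 0 \<and> component 2 7 v \<noteq> 0 \<and> component 3 6 v \<noteq> 0 \<and> component 4 5 v \<noteq> 0}"

definition V_a :: "(bit ^ 8) set" where "V_a = vec.span {basis_vec 1, basis_vec 8}"
definition V_b :: "(bit ^ 8) set" where "V_b = vec.span {basis_vec 2, basis_vec 7}"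
definition V_c :: "(bit ^ 8) set" where "V_c = vec.span {basis_vec 3, basis_vec 6}"
definition V_d :: "(bit ^ 8) set" where "V_d = vec.span {basis_vec 4, basis_vec 5}"

definition proj_points :: "(bit ^ 8) set \<Rightarrow> (bit ^ 8) set" where
  "proj_points W = W - {0}"

text \<open>
  The linear map \<open>e\<^sub>m \<mapsto> e\<^sub>n \<mapsto> e\<^sub>m + e\<^sub>n \<mapsto> e\<^sub>m\<close> on \<open>\<langle>e\<^sub>m, e\<^sub>n\<rangle>\<close>, extended by \<open>0\<close> on the
  other basis vectors. It is only ever applied to vectors of \<open>\<langle>e\<^sub>m, e\<^sub>n\<rangle>\<close>.
\<close>

definition rot :: "8 \<Rightarrow> 8 \<Rightarrow> bit ^ 8 \<Rightarrow> bit ^ 8" where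
  "rot m n v = v $ m *s basis_vec n + v $ n *s (basis_vec m + basis_vec n)"

definition zeta_a :: "bit ^ 8 \<Rightarrow> bit ^ 8" where "zeta_a = rot 1 8"
definition zeta_b :: "bit ^ 8 \<Rightarrow> bit ^ 8" where "zeta_b = rot 7 2"
definition zeta_c :: "bit ^ 8 \<Rightarrow> bit ^ 8" where "zeta_c = rot 3 6"
definition zeta_d :: "bit ^ 8 \<Rightarrow> bit ^ 8" where "zeta_d = rot 5 4"

text \<open>The power \<open>f\<^sup>i\<close> of a map of order \<open>3\<close>, with exponent in \<open>\<bbbF>\<^sub>3\<close>.\<close>

definition pow3 :: "('a \<Rightarrow> 'a) \<Rightarrow> 3 \<Rightarrow> 'a \<Rightarrow> 'a" where
  "pow3 f i = (if i = 0 then id else if i = 1 then f else f \<circ> f)"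

definition A_map :: "3 ^ 4 \<Rightarrow> bit ^ 8 \<Rightarrow> bit ^ 8" where
  "A_map l v = pow3 zeta_a (l $ 1) (component 1 8 v) + pow3 zeta_b (l $ 2) (component 2 7 v)
         + pow3 zeta_c (l $ 3) (component 3 6 v) + pow3 zeta_d (l $ 4) (component 4 5 v)"

definition all_ones :: "bit ^ 8" where
  "all_ones = (\<Sum>i\<in>UNIV. basis_vec i)"

definition point :: "3 ^ 4 \<Rightarrow> bit ^ 8" where
  "point l = A_map l all_ones"

definition Xi_beta :: "3 ^ 4" where "Xi_beta = vector [1, 2, 2, 1]"
definition Xi_gamma :: "3 ^ 4" where "Xi_gamma = vector [2, 1, 2, 1]"
definition Xi_delta :: "3 ^ 4" where "Xi_delta = vector [2, 2, 1, 1]"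
definition Xi_alpha :: "3 ^ 4" where "Xi_alpha = vector [1, 1, 1, 1]"

definition Xi_coords :: "3 ^ 4 \<Rightarrow> 3 ^ 4" where
  "Xi_coords l = (THE c. l = c $ 1 *s Xi_beta + c $ 2 *s Xi_gamma + c $ 3 *s Xi_delta + c $ 4 *s Xi_alpha)"

definition wt_Xi :: "3 ^ 4 \<Rightarrow> nat" where
  "wt_Xi l = card {m. Xi_coords l $ m \<noteq> 0}"

text \<open>Meaningful for points of \<open>omega4 = range point\<close> only.\<close>

definition hd_dist :: "bit ^ 8 \<Rightarrow> bit ^ 8 \<Rightarrow> nat" where
  "hd_dist p q = wt_Xi (the_inv point p - the_inv point q)"

text \<open>
  \<open>V(2,2)\<^sup>\<otimes>\<^sup>3\<close> is realised as the space of \<open>2 \<times> 2 \<times> 2\<close> arrays over \<open>\<bbbF>\<^sub>2\<close>, and the pure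
  tensor \<open>x \<otimes> y \<otimes> z\<close> as the array with entries \<open>x\<^sub>i y\<^sub>j z\<^sub>k\<close>.
\<close>

type_synonym tensor3 = "bit ^ (2 \<times> 2 \<times> 2)"

definition pure_tensor :: "bit ^ 2 \<Rightarrow> bit ^ 2 \<Rightarrow> bit ^ 2 \<Rightarrow> tensor3" where
  "pure_tensor x y z = (\<chi> m. case m of (i, j, k) \<Rightarrow> x $ i * y $ j * z $ k)"

definition linear_iso :: "(tensor3 \<Rightarrow> bit ^ 8) \<Rightarrow> bool" where
  "linear_iso \<phi> \<longleftrightarrow> Vector_Spaces.linear (*s) (*s) \<phi> \<and> bij \<phi>"

text \<open>
  A Segre variety is presented by an isomorphism \<open>\<phi>\<close>. Its generators depend only on the point
  set \<open>segre \<phi>\<close>: they are exactly the lines of \<open>PG(7,2)\<close> contained in it.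
\<close>

definition segre :: "(tensor3 \<Rightarrow> bit ^ 8) \<Rightarrow> (bit ^ 8) set" where
  "segre \<phi> = {\<phi> (pure_tensor x y z) | x y z. x \<noteq> 0 \<and> y \<noteq> 0 \<and> z \<noteq> 0}"

definition generators :: "(tensor3 \<Rightarrow> bit ^ 8) \<Rightarrow> (bit ^ 8) set set" where
  "generators \<phi> =
     {{\<phi> (pure_tensor x y z) | x. x \<noteq> 0} | y z. y \<noteq> 0 \<and> z \<noteq> 0} \<union>
     {{\<phi> (pure_tensor x y z) | y. y \<noteq> 0} | x z. x \<noteq> 0 \<and> z \<noteq> 0} \<union>
     {{\<phi> (pure_tensor x y z) | z. z \<noteq> 0} | x y. x \<noteq> 0 \<and> y \<noteq> 0}"

definition fan :: "(tensor3 \<Rightarrow> bit ^ 8) \<Rightarrow> (bit ^ 8) set \<Rightarrow> bool" where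
  "fan \<phi> F \<longleftrightarrow> F \<subseteq> segre \<phi> \<and> card F = 9 \<and>
     (\<forall>p\<in>F. \<forall>q\<in>F. p \<noteq> q \<longrightarrow> \<not> (\<exists>l\<in>generators \<phi>. p \<in> l \<and> q \<in> l))"

definition troika :: "(bit ^ 8) set \<Rightarrow> (bit ^ 8) set \<Rightarrow> bool" where
  "troika S t \<longleftrightarrow> t \<subseteq> S \<and> card t = 3 \<and> (\<forall>p\<in>t. \<forall>q\<in>t. p \<noteq> q \<longrightarrow> hd_dist p q = 3)"

definition centre :: "(bit ^ 8) set \<Rightarrow> bit ^ 8" where
  "centre t = (\<Sum>p\<in>t. p)"

definition troika_triplet :: "(bit ^ 8) set \<Rightarrow> (bit ^ 8) set \<Rightarrow> (bit ^ 8) set set \<Rightarrow> bool" where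
  "troika_triplet S F P \<longleftrightarrow> card P = 3 \<and> (\<forall>t\<in>P. troika S t) \<and> \<Union>P = F"

text \<open>The common centre of the troikas making up \<open>F\<close>.\<close>

definition fan_centre :: "(bit ^ 8) set \<Rightarrow> (bit ^ 8) set \<Rightarrow> bit ^ 8" where
  "fan_centre S F = (THE c. \<exists>P. troika_triplet S F P \<and> (\<forall>t\<in>P. centre t = c))"

definition fan_triplet :: "(tensor3 \<Rightarrow> bit ^ 8) \<Rightarrow> (bit ^ 8) set set \<Rightarrow> bool" where
  "fan_triplet \<phi> T \<longleftrightarrow> card T = 3 \<and> (\<forall>F\<in>T. fan \<phi> F) \<and> \<Union>T = segre \<phi>"

definition centre_set :: "(bit ^ 8) set \<Rightarrow> (bit ^ 8) set set \<Rightarrow> (bit ^ 8) set" where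
  "centre_set S T = fan_centre S ` T"

subsection \<open>Well-definedness of the coordinates and of the labelling of points\<close>

lemma Xi_coords_unique:
  fixes l :: "3 ^ 4"
  shows "\<exists>!c :: 3 ^ 4. l = c $ 1 *s Xi_beta + c $ 2 *s Xi_gamma + c $ 3 *s Xi_delta + c $ 4 *s Xi_alpha"
proof -
  have vec4 [simp]: "(vector [x, y, z, w] :: 3 ^ 4) $ 1 = x" "(vector [x, y, z, w] :: 3 ^ 4) $ 2 = y"
    "(vector [x, y, z, w] :: 3 ^ 4) $ 3 = z" "(vector [x, y, z, w] :: 3 ^ 4) $ 4 = w" for x y z w
    unfolding vector_def by auto
  have two [simp]: "(2::3) = -1" by simp
  have d [simp]: "x + x = - x" for x :: 3
    using mult_2[of x] by (simp only: two) simp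
  have d' [simp]: "x + (x + y) = y - x" for x y :: 3
    by (simp only: add.assoc[symmetric] d) simp
  define f where "f c = c $ 1 *s Xi_beta + c $ 2 *s Xi_gamma + c $ 3 *s Xi_delta + c $ 4 *s Xi_alpha" for c :: "3 ^ 4"
  define g :: "3 ^ 4 \<Rightarrow> 3 ^ 4" where
    "g l = vector [l$1-l$2-l$3+l$4, l$2-l$1-l$3+l$4, l$3-l$1-l$2+l$4, l$1+l$2+l$3+l$4]" for l
  have "f (g l) = l" for l
    by (simp add: f_def g_def vec_eq_iff forall_4 Xi_beta_def Xi_gamma_def Xi_delta_def Xi_alpha_def algebra_simps)
  moreover have "g (f c) = c" for c
    by (simp add: f_def g_def vec_eq_iff forall_4 Xi_beta_def Xi_gamma_def Xi_delta_def Xi_alpha_def algebra_simps)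
  ultimately have "\<exists>!c. l = f c"
    by metis
  then show ?thesis
    unfolding f_def .
qed

lemma pow3_rot:
  assumes "m \<noteq> n"
  shows "pow3 (rot m n) i (component m n all_ones) =
           (if i = 2 then 0 else basis_vec m) + (if i = 1 then 0 else basis_vec n)"
proof -
  have one: "all_ones $ j = 1" for j
    by (simp add: all_ones_def basis_vec_def axis_def)
  consider "i = 0" | "i = 1" | "i = 2"
    using exhaust_3[of i] by fastforce
  then show ?thesis
    using assms
    by cases (auto simp: pow3_def rot_def component_def one vec_eq_iff basis_vec_def axis_def)
qed

lemma point_eq:
  "point l =
     ((if l $ 1 = 2 then 0 else basis_vec 1) + (if l $ 1 = 1 then 0 else basis_vec 8)) +
     ((if l $ 2 = 2 then 0 else basis_vec 7) + (if l $ 2 = 1 then 0 else basis_vec 2)) +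
     ((if l $ 3 = 2 then 0 else basis_vec 3) + (if l $ 3 = 1 then 0 else basis_vec 6)) +
     ((if l $ 4 = 2 then 0 else basis_vec 5) + (if l $ 4 = 1 then 0 else basis_vec 4))"
proof -
  have "component 2 7 all_ones = component 7 2 all_ones" "component 4 5 all_ones = component 5 4 all_ones"
    by (simp_all add: component_def add.commute)
  then show ?thesis
    by (simp add: point_def A_map_def zeta_a_def zeta_b_def zeta_c_def zeta_d_def pow3_rot)
qed

lemma component_eq_0_iff:
  assumes "m \<noteq> n"
  shows "component m n v = 0 \<longleftrightarrow> v $ m = 0 \<and> v $ n = 0"
  using assms by (auto simp: component_def basis_vec_def vec_eq_iff axis_def)

lemma exhaust_8: "(i::8) = 1 \<or> i = 2 \<or> i = 3 \<or> i = 4 \<or> i = 5 \<or> i = 6 \<or> i = 7 \<or> i = 8"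
proof (induct i)
  case (of_int z)
  then have "0 \<le> z" "z < 8" by simp_all
  then have "z = 0 \<or> z = 1 \<or> z = 2 \<or> z = 3 \<or> z = 4 \<or> z = 5 \<or> z = 6 \<or> z = 7" by arith
  then show ?case by auto
qed

lemma forall_8: "(\<forall>i::8. P i) \<longleftrightarrow> P 1 \<and> P 2 \<and> P 3 \<and> P 4 \<and> P 5 \<and> P 6 \<and> P 7 \<and> P 8"
  by (metis exhaust_8)

lemma point_coords:
  "point l $ 1 = (if l $ 1 = 2 then 0 else 1)" "point l $ 8 = (if l $ 1 = 1 then 0 else 1)"
  "point l $ 7 = (if l $ 2 = 2 then 0 else 1)" "point l $ 2 = (if l $ 2 = 1 then 0 else 1)"
  "point l $ 3 = (if l $ 3 = 2 then 0 else 1)" "point l $ 6 = (if l $ 3 = 1 then 0 else 1)"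
  "point l $ 5 = (if l $ 4 = 2 then 0 else 1)" "point l $ 4 = (if l $ 4 = 1 then 0 else 1)"
  by (simp_all add: point_eq basis_vec_def axis_def)

lemma mod3_eqI:
  fixes x y :: 3
  assumes "x = 2 \<longleftrightarrow> y = 2" "x = 1 \<longleftrightarrow> y = 1"
  shows "x = y"
  using exhaust_3[of x] exhaust_3[of y] assms by auto

lemma bij_betw_point: "bij_betw point UNIV omega4"
proof (rule bij_betw_imageI)
  show "inj point"
  proof (rule injI)
    fix l l' assume eq: "point l = point l'"
    have *: "point l $ i = point l' $ i" for i
      by (simp add: eq)
    have "l $ 1 = l' $ 1"
      using *[of 1] *[of 8] by (intro mod3_eqI) (auto simp only: point_coords split: if_splits)
    moreover have "l $ 2 = l' $ 2"
      using *[of 7] *[of 2] by (intro mod3_eqI) (auto simp only: point_coords split: if_splits)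
    moreover have "l $ 3 = l' $ 3"
      using *[of 3] *[of 6] by (intro mod3_eqI) (auto simp only: point_coords split: if_splits)
    moreover have "l $ 4 = l' $ 4"
      using *[of 5] *[of 4] by (intro mod3_eqI) (auto simp only: point_coords split: if_splits)
    ultimately show "l = l'"
      by (simp only: vec_eq_iff forall_4)
  qed
  show "range point = omega4"
  proof (intro equalityI subsetI)
    fix v assume "v \<in> range point"
    then show "v \<in> omega4"
      by (auto simp: omega4_def component_eq_0_iff point_coords)
  next
    fix v assume v: "v \<in> omega4"
    define f :: "bit \<Rightarrow> bit \<Rightarrow> 3" where "f x y = (if x = 0 then 2 else if y = 0 then 1 else 0)" for x y
    define l :: "3 ^ 4" where
      "l = (\<chi> i. if i = 1 then f (v $ 1) (v $ 8) else if i = 2 then f (v $ 7) (v $ 2)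
                 else if i = 3 then f (v $ 3) (v $ 6) else f (v $ 5) (v $ 4))"
    have nz: "v $ 1 \<noteq> 0 \<or> v $ 8 \<noteq> 0" "v $ 7 \<noteq> 0 \<or> v $ 2 \<noteq> 0" "v $ 3 \<noteq> 0 \<or> v $ 6 \<noteq> 0" "v $ 5 \<noteq> 0 \<or> v $ 4 \<noteq> 0"
      using v by (auto simp: omega4_def component_eq_0_iff)
    have f: "(if f x y = 2 then 0 else 1) = x" "x \<noteq> 0 \<or> y \<noteq> 0 \<Longrightarrow> (if f x y = 1 then 0 else 1) = y" for x y
      by (auto simp: f_def)
    have "l $ 1 = f (v $ 1) (v $ 8)" "l $ 2 = f (v $ 7) (v $ 2)" "l $ 3 = f (v $ 3) (v $ 6)" "l $ 4 = f (v $ 5) (v $ 4)"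
      by (simp_all add: l_def)
    then have "point l = v"
      by (simp only: vec_eq_iff forall_8 point_coords f nz simp_thms)
    then show "v \<in> range point"
      by blast
  qed
qed

end

theory Submission
  imports Defs
begin

text \<open>
  Identify \<open>\<omega>\<^sub>4\<close> with \<open>\<bbbF>\<^sub>3\<^sup>4\<close> through the labels \<open>\<lambda>\<close>, and index the Segre variety by \<open>\<bbbF>\<^sub>3\<^sup>3\<close>. The points
  \<open>p, q, p + q\<close> of a generator differ in each of the four labels, so each label is a Latin cube
  of order 3 on the index set, and such a cube is an affine function whose three coefficients are
  nonzero. As the variety spans \<open>V\<^sub>8\<close>, no two of the four linear parts are proportional; they
  therefore represent all four sign vectors \<open>(1, \<plusminus>1, \<plusminus>1)\<close>. A fan is the graph of a Latin square,
  again an affine plane with nonzero coefficients, so the fans are exactly the twelve level sets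
  of the four labels. Two points of the level set of the \<open>m\<close>-th label are at distance 3 iff the
  other three labels all differ, which happens in a single direction of the plane: the troikas
  are the parallel lines in this direction. In their vector sums the three components where the
  labels vary cancel, and the constant component remains. Level sets of different labels meet,
  so the triplet of fans consists of the three level sets of one label.
\<close>

section \<open>Arithmetic in the field with three elements\<close>

lemma three_eq_0 [simp]: "(3::3) = 0" by simp

lemma cases_3: obtains "i = (0::3)" | "i = 1" | "i = 2"
  using exhaust_3[of i] by fastforce

lemma all_3: "(\<forall>i::3. P i) \<longleftrightarrow> P 0 \<and> P 1 \<and> P 2"
  by (metis cases_3)

lemma UNIV_3: "(UNIV :: 3 set) = {0, 1, 2}"
  using cases_3 by blast

text \<open>The nonzero elements are 1 and -1, each its own inverse; multiplying twice by one of
  them takes the place of division.\<close>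

lemma nonzero_square_3:
  fixes x y :: 3
  assumes "x \<noteq> 0"
  shows "x * x = 1" "x * (x * y) = y"
  using assms by (cases x rule: cases_3; simp; cases y rule: cases_3; simp)+

lemma nonzero_3_mult_neq_0: "x * y \<noteq> 0" if "x \<noteq> 0" "y \<noteq> 0" for x y :: 3
  using that by (cases x rule: cases_3; cases y rule: cases_3) auto

lemma nonzero_3_iff: "x \<noteq> 0 \<longleftrightarrow> x \<in> {1, 2}" for x :: 3
  by (cases x rule: cases_3) auto

section \<open>Latin squares and cubes of order 3\<close>

text \<open>Three distinct elements of F_3 add up to 0, which says that the second difference of
  \<open>f\<close> vanishes.\<close>

lemma inj_imp_affine_3:
  fixes f :: "3 \<Rightarrow> 3"
  assumes "inj f"
  shows "\<exists>a. a \<noteq> 0 \<and> (\<forall>i. f i = f 0 + a * i)"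
proof -
  have "f 0 \<noteq> f 1" "f 0 \<noteq> f 2" "f 1 \<noteq> f 2"
    using assms by (auto simp: inj_eq)
  then have "f 1 - f 0 \<noteq> 0 \<and> (\<forall>i. f i = f 0 + (f 1 - f 0) * i)"
    by (cases "f 0" rule: cases_3; cases "f 1" rule: cases_3; cases "f 2" rule: cases_3)
      (auto simp: all_3)
  then show ?thesis ..
qed

text \<open>A nonzero slope would make the function a bijection of F_3, so it would take the value
  0.\<close>

lemma affine_nonzero_imp_const_3:
  fixes a x :: 3
  assumes "\<And>j. a + x * j \<noteq> 0"
  shows "x = 0"
  using assms[of 0] assms[of 1] assms[of 2]
  by (cases a rule: cases_3; cases x rule: cases_3) auto

text \<open>
  Every row and every column is affine, so the slope of a row is an affine function of its index.
  That function never vanishes, hence is constant.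
\<close>

lemma latin_square_affine:
  fixes g :: "3 \<Rightarrow> 3 \<Rightarrow> 3"
  assumes "\<And>j. inj (\<lambda>i. g i j)" and "\<And>i. inj (g i)"
  shows "\<exists>a b. a \<noteq> 0 \<and> b \<noteq> 0 \<and> (\<forall>i j. g i j = g 0 0 + a * i + b * j)"
proof -
  obtain a where a: "\<And>j. a j \<noteq> 0" "\<And>i j. g i j = g 0 j + a j * i"
    using inj_imp_affine_3[OF assms(1)] by metis
  obtain b where b: "\<And>i. b i \<noteq> 0" "\<And>i j. g i j = g i 0 + b i * j"
    using inj_imp_affine_3[OF assms(2)] by metis
  \<comment> \<open>The value \<open>g 1 j\<close> is reached from \<open>g 0 j\<close> with slope
    \<open>a j\<close> and from \<open>g 1 0\<close> with slope \<open>b 1\<close>; comparing the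
    two gives \<open>a j\<close>.\<close>
  have aj: "a j = a 0 + (b 1 - b 0) * j" for j
    using a(2)[of 1 j] a(2)[of 1 0] b(2)[of 0 j] b(2)[of 1 j] by (simp add: algebra_simps)
  have "b 1 - b 0 = 0"
    using a(1) aj by (intro affine_nonzero_imp_const_3[of "a 0"]) metis
  then have "g i j = g 0 0 + a 0 * i + b 0 * j" for i j
    using a(2)[of i j] b(2)[of 0 j] aj[of j] by (simp add: algebra_simps)
  then show ?thesis
    using a(1) b(1) by blast
qed

text \<open>Each layer is affine with slopes that may depend on \<open>k\<close>. The faces
  \<open>j = 0\<close> and \<open>i = 0\<close> are affine as well and show these slopes to be
  constant.\<close>

lemma latin_cube_affine:
  fixes g :: "3 \<Rightarrow> 3 \<Rightarrow> 3 \<Rightarrow> 3"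
  assumes "\<And>j k. inj (\<lambda>i. g i j k)" and "\<And>i k. inj (\<lambda>j. g i j k)" and "\<And>i j. inj (g i j)"
  shows "\<exists>a b d. a \<noteq> 0 \<and> b \<noteq> 0 \<and> d \<noteq> 0 \<and> (\<forall>i j k. g i j k = g 0 0 0 + a * i + b * j + d * k)"
proof -
  have "\<forall>k. \<exists>a b. a \<noteq> 0 \<and> b \<noteq> 0 \<and> (\<forall>i j. g i j k = g 0 0 k + a * i + b * j)"
    using latin_square_affine[of "\<lambda>i j. g i j k" for k] assms by simp
  then obtain a b where ab: "\<And>i j k. g i j k = g 0 0 k + a k * i + b k * j"
    by metis
  obtain a' d where a': "a' \<noteq> 0" "\<And>i k. g i 0 k = g 0 0 0 + a' * i + d * k"
    using latin_square_affine[of "\<lambda>i k. g i 0 k"] assms by auto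
  obtain b' d' where b': "b' \<noteq> 0" "d' \<noteq> 0" "\<And>j k. g 0 j k = g 0 0 0 + b' * j + d' * k"
    using latin_square_affine[of "\<lambda>j k. g 0 j k"] assms by auto
  have "g i j k = g 0 0 0 + a' * i + b' * j + d' * k" for i j k
    using ab[of i j k] ab[of i 0 k] ab[of 0 j k] a'(2)[of i k] b'(3)[of j k] a'(2)[of 0 k] b'(3)[of 0 k]
    by (simp add: algebra_simps)
  then show ?thesis
    using a'(1) b'(1,2) by blast
qed

section \<open>Labels and coordinates of the points of \<open>omega4\<close>\<close>

text \<open>
  In the \<open>m\<close>-th plane the orientation of \<open>\<zeta>\<close> is such that the label 2 kills the coordinate
  \<open>P_index m\<close> and the label 1 kills \<open>Q_index m\<close>.
\<close>

definition P_index :: "4 \<Rightarrow> 8" where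
  "P_index m = (if m = 1 then 1 else if m = 2 then 7 else if m = 3 then 3 else 5)"

definition Q_index :: "4 \<Rightarrow> 8" where
  "Q_index m = (if m = 1 then 8 else if m = 2 then 2 else if m = 3 then 6 else 4)"

lemma point_bits:
  "point l $ P_index m = (if l $ m = 2 then 0 else 1)"
  "point l $ Q_index m = (if l $ m = 1 then 0 else 1)"
  using exhaust_4[of m] by (auto simp: P_index_def Q_index_def point_coords)

lemma index_cases:
  obtains m where "i = P_index m" | m where "i = Q_index m"
proof -
  have "i \<in> {P_index 1, P_index 2, P_index 3, P_index 4, Q_index 1, Q_index 2, Q_index 3, Q_index 4}"
    using exhaust_8[of i] by (auto simp: P_index_def Q_index_def)
  then show thesis
    using that by blast
qed

lemma index_eq_iff [simp]:
  "P_index m = P_index n \<longleftrightarrow> m = n" "Q_index m = Q_index n \<longleftrightarrow> m = n"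
  "P_index m \<noteq> Q_index n" "Q_index m \<noteq> P_index n"
  using exhaust_4[of m] exhaust_4[of n] by (auto simp: P_index_def Q_index_def)

text \<open>If the labels agreed, the two components in the \<open>m\<close>-th plane would cancel
  and leave the third point with component 0 there.\<close>

lemma point_collinear:
  assumes "point l + point l' + point l'' = 0"
  shows "l $ m \<noteq> l' $ m"
proof -
  have "(point l + point l' + point l'') $ P_index m = 0" "(point l + point l' + point l'') $ Q_index m = 0"
    using assms by simp_all
  then show ?thesis
    by (auto simp: point_bits split: if_splits)
qed

text \<open>Three distinct labels yield all three nonzero vectors of the plane, and these add up to
  0.\<close>

lemma sum_points_coordinate:
  assumes "l $ m \<noteq> l' $ m" "l $ m \<noteq> l'' $ m" "l' $ m \<noteq> l'' $ m"
  shows "(point l + point l' + point l'') $ P_index m = 0" "(point l + point l' + point l'') $ Q_index m = 0"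
  using assms
  by (cases "l $ m" rule: cases_3; cases "l' $ m" rule: cases_3; cases "l'' $ m" rule: cases_3;
      simp add: point_bits)+

lemma vector_4 [simp]:
  fixes x y z w :: "'a :: zero"
  shows "(vector [x, y, z, w] :: 'a ^ 4) $ 1 = x" "(vector [x, y, z, w] :: 'a ^ 4) $ 2 = y"
    "(vector [x, y, z, w] :: 'a ^ 4) $ 3 = z" "(vector [x, y, z, w] :: 'a ^ 4) $ 4 = w"
  unfolding vector_def by auto

section \<open>Hamming distance in terms of labels\<close>

lemma Xi_coords_eq:
  "Xi_coords l = vector [l$1-l$2-l$3+l$4, l$2-l$1-l$3+l$4, l$3-l$1-l$2+l$4, l$1+l$2+l$3+l$4]" (is "_ = ?c")
proof -
  have two [simp]: "(2::3) = -1" by simp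
  have d [simp]: "x + x = - x" for x :: 3
    using mult_2[of x] by (simp only: two) simp
  have d' [simp]: "x + (x + y) = y - x" for x y :: 3
    by (simp only: add.assoc[symmetric] d) simp
  have "l = ?c $ 1 *s Xi_beta + ?c $ 2 *s Xi_gamma + ?c $ 3 *s Xi_delta + ?c $ 4 *s Xi_alpha"
    by (simp add: vec_eq_iff forall_4 Xi_beta_def Xi_gamma_def Xi_delta_def Xi_alpha_def algebra_simps)
  then show ?thesis
    unfolding Xi_coords_def by (intro the1_equality[OF Xi_coords_unique])
qed

lemma card_Collect_4:
  "card {m::4. Q m} = of_bool (Q 1) + of_bool (Q 2) + of_bool (Q 3) + of_bool (Q 4)"
proof -
  have "card {m::4. Q m} = (\<Sum>m\<in>UNIV. of_bool (Q m))"
    by (simp add: sum.If_cases of_bool_def)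
  also have "\<dots> = of_bool (Q 1) + of_bool (Q 2) + of_bool (Q 3) + of_bool (Q 4)"
    by (simp add: sum_4)
  finally show ?thesis .
qed

text \<open>
  \<open>\<Xi>\<close> is orthogonal for the dot product, so the \<open>\<Xi>\<close>-coordinates are dot products with its
  members. A vector of ordinary weight 3 is orthogonal to exactly one of them.
\<close>

lemma wt_Xi_eq_3_iff:
  assumes "l $ m = 0"
  shows "wt_Xi l = 3 \<longleftrightarrow> (\<forall>n. n \<noteq> m \<longrightarrow> l $ n \<noteq> 0)"
proof -
  show ?thesis
    using assms exhaust_4[of m]
    unfolding wt_Xi_def card_Collect_4 Xi_coords_eq vector_4 forall_4
    by (cases "l $ 1" rule: cases_3; cases "l $ 2" rule: cases_3; cases "l $ 3" rule: cases_3;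
       cases "l $ 4" rule: cases_3) auto
qed

section \<open>Pure tensors over the field with two elements\<close>

lemma pure_tensor_add:
  "pure_tensor (x + x') y z = pure_tensor x y z + pure_tensor x' y z"
  "pure_tensor x (y + y') z = pure_tensor x y z + pure_tensor x y' z"
  "pure_tensor x y (z + z') = pure_tensor x y z + pure_tensor x y z'"
  by (auto simp: pure_tensor_def vec_eq_iff algebra_simps)

lemma bit_vec_add_self [simp]: "(v :: bit ^ 'n) + v = 0"
  by (simp add: vec_eq_iff)

lemma bit_vec_add_eq_0_iff: "(u :: bit ^ 'n) + v = 0 \<longleftrightarrow> u = v"
  by (metis add.assoc add.left_neutral add.right_neutral bit_vec_add_self)

text \<open>The numbering follows the pattern of the labels: 2 kills the first coordinate, 1 the
  second, and 0 gives the all-one vector.\<close>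

definition nonzero_vec :: "3 \<Rightarrow> bit ^ 2" where
  "nonzero_vec i = vector [if i = 2 then 0 else 1, if i = 1 then 0 else 1]"

lemma nonzero_vec_neq_0: "nonzero_vec i \<noteq> 0"
  by (auto simp: nonzero_vec_def vec_eq_iff forall_2)

lemma nonzero_vec_cases:
  assumes "x \<noteq> 0"
  obtains i where "x = nonzero_vec i"
proof -
  have "x = nonzero_vec (if x $ 1 = 0 then 2 else if x $ 2 = 0 then 1 else 0)"
    using assms by (auto simp: nonzero_vec_def vec_eq_iff forall_2)
  then show thesis
    using that by blast
qed

definition label :: "bit ^ 8 \<Rightarrow> 3 ^ 4" where
  "label = the_inv point"

lemma point_label: "p \<in> omega4 \<Longrightarrow> point (label p) = p"
  using bij_betw_point unfolding label_def bij_betw_def by (metis f_the_inv_into_f)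

lemma label_collinear:
  assumes "p \<in> omega4" "q \<in> omega4" "p + q \<in> omega4"
  shows "label p $ m \<noteq> label q $ m"
  using assms by (intro point_collinear[where l'' = "label (p + q)"]) (simp add: point_label)

section \<open>The Segre variety as a grid indexed by triples over F_3\<close>

locale omega4_segre =
  fixes \<phi> :: "tensor3 \<Rightarrow> bit ^ 8"
  assumes iso: "linear_iso \<phi>" and sub: "segre \<phi> \<subseteq> omega4"
begin

definition grid :: "3 \<Rightarrow> 3 \<Rightarrow> 3 \<Rightarrow> bit ^ 8" where
  "grid i j k = \<phi> (pure_tensor (nonzero_vec i) (nonzero_vec j) (nonzero_vec k))"

lemma module_hom_\<phi>: "module_hom (*s) (*s) \<phi>"
  using iso by (simp add: linear_iso_def module_hom_iff_linear)

lemma \<phi>_add: "\<phi> (s + t) = \<phi> s + \<phi> t"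
  using module_hom.add[OF module_hom_\<phi>] .

lemma segre_eq: "segre \<phi> = {grid i j k | i j k. True}"
proof (intro equalityI subsetI)
  fix p assume "p \<in> segre \<phi>"
  then obtain x y z where "p = \<phi> (pure_tensor x y z)" "x \<noteq> 0" "y \<noteq> 0" "z \<noteq> 0"
    by (auto simp: segre_def)
  then show "p \<in> {grid i j k | i j k. True}"
    unfolding grid_def by (elim nonzero_vec_cases) blast
next
  fix p assume "p \<in> {grid i j k | i j k. True}"
  then show "p \<in> segre \<phi>"
    unfolding grid_def segre_def using nonzero_vec_neq_0 by blast
qed

lemma grid_in_segre [simp]: "grid i j k \<in> segre \<phi>"
  by (auto simp: segre_eq)

lemma segre_cases:
  assumes "p \<in> segre \<phi>"
  obtains i j k where "p = grid i j k"
  using assms by (auto simp: segre_eq)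

lemma point_label_segre: "p \<in> segre \<phi> \<Longrightarrow> point (label p) = p"
  using point_label sub by blast

text \<open>Two points of a generator share two tensor factors, so their sum is again pure; its
  third factor is nonzero because the points differ.\<close>

lemma generator_add:
  assumes "l \<in> generators \<phi>" "p \<in> l" "q \<in> l" "p \<noteq> q"
  shows "p \<in> segre \<phi>" "q \<in> segre \<phi>" "p + q \<in> segre \<phi>"
proof -
  have pure: "\<phi> (pure_tensor x y z) \<in> segre \<phi>" if "x \<noteq> 0" "y \<noteq> 0" "z \<noteq> 0" for x y z
    using that by (auto simp: segre_def)
  have add_nz: "x + x' \<noteq> 0" if "x \<noteq> x'" for x x' :: "bit ^ 2"
    using that bit_vec_add_eq_0_iff by blast
  consider x x' y z where "p = \<phi> (pure_tensor x y z)" "q = \<phi> (pure_tensor x' y z)" "x \<noteq> 0" "x' \<noteq> 0" "y \<noteq> 0" "z \<noteq> 0"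
    | x y y' z where "p = \<phi> (pure_tensor x y z)" "q = \<phi> (pure_tensor x y' z)" "x \<noteq> 0" "y \<noteq> 0" "y' \<noteq> 0" "z \<noteq> 0"
    | x y z z' where "p = \<phi> (pure_tensor x y z)" "q = \<phi> (pure_tensor x y z')" "x \<noteq> 0" "y \<noteq> 0" "z \<noteq> 0" "z' \<noteq> 0"
    using assms(1-3) unfolding generators_def Un_iff mem_Collect_eq by (elim disjE exE conjE) auto
  then have "p \<in> segre \<phi> \<and> q \<in> segre \<phi> \<and> p + q \<in> segre \<phi>"
  proof cases
    case 1
    then have "x \<noteq> x'"
      using assms(4) by metis
    with 1 show ?thesis
      by (simp add: \<phi>_add[symmetric] pure_tensor_add[symmetric] pure add_nz)
  next
    case 2
    then have "y \<noteq> y'"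
      using assms(4) by metis
    with 2 show ?thesis
      by (simp add: \<phi>_add[symmetric] pure_tensor_add[symmetric] pure add_nz)
  next
    case 3
    then have "z \<noteq> z'"
      using assms(4) by metis
    with 3 show ?thesis
      by (simp add: \<phi>_add[symmetric] pure_tensor_add[symmetric] pure add_nz)
  qed
  then show "p \<in> segre \<phi>" "q \<in> segre \<phi>" "p + q \<in> segre \<phi>"
    by simp_all
qed

lemma label_generator:
  assumes "l \<in> generators \<phi>" "p \<in> l" "q \<in> l" "p \<noteq> q"
  shows "label p $ m \<noteq> label q $ m"
  using generator_add[OF assms] sub by (intro label_collinear) auto

lemma inj_nonzero_vec: "inj nonzero_vec"
proof (rule injI)
  fix i j assume "nonzero_vec i = nonzero_vec j"
  then have "nonzero_vec i $ 1 = nonzero_vec j $ 1" "nonzero_vec i $ 2 = nonzero_vec j $ 2"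
    by simp_all
  then show "i = j"
    by (cases i rule: cases_3; cases j rule: cases_3) (simp_all add: nonzero_vec_def)
qed

lemma grid_line:
  "\<exists>l\<in>generators \<phi>. \<forall>i. grid i j k \<in> l"
  "\<exists>l\<in>generators \<phi>. \<forall>j. grid i j k \<in> l"
  "\<exists>l\<in>generators \<phi>. \<forall>k. grid i j k \<in> l"
proof -
  have "{\<phi> (pure_tensor x (nonzero_vec j) (nonzero_vec k)) |x. x \<noteq> 0} \<in> generators \<phi>" (is "?l1 \<in> _")
    unfolding generators_def by (rule UnI1, rule UnI1, (rule CollectI exI conjI refl nonzero_vec_neq_0)+)
  moreover have "grid i j k \<in> ?l1" for i
    unfolding grid_def by (rule CollectI exI conjI refl nonzero_vec_neq_0)+
  ultimately show "\<exists>l\<in>generators \<phi>. \<forall>i. grid i j k \<in> l"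
    by blast
  have "{\<phi> (pure_tensor (nonzero_vec i) y (nonzero_vec k)) |y. y \<noteq> 0} \<in> generators \<phi>" (is "?l2 \<in> _")
    unfolding generators_def by (rule UnI1, rule UnI2, (rule CollectI exI conjI refl nonzero_vec_neq_0)+)
  moreover have "grid i j k \<in> ?l2" for j
    unfolding grid_def by (rule CollectI exI conjI refl nonzero_vec_neq_0)+
  ultimately show "\<exists>l\<in>generators \<phi>. \<forall>j. grid i j k \<in> l"
    by blast
  have "{\<phi> (pure_tensor (nonzero_vec i) (nonzero_vec j) z) |z. z \<noteq> 0} \<in> generators \<phi>" (is "?l3 \<in> _")
    unfolding generators_def by (rule UnI2, (rule CollectI exI conjI refl nonzero_vec_neq_0)+)
  moreover have "grid i j k \<in> ?l3" for k
    unfolding grid_def by (rule CollectI exI conjI refl nonzero_vec_neq_0)+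
  ultimately show "\<exists>l\<in>generators \<phi>. \<forall>k. grid i j k \<in> l"
    by blast
qed

text \<open>The sum of the two points is the image of a pure tensor with nonzero factors. It lies in
  \<open>omega4\<close>, which does not contain 0.\<close>

lemma grid_neq:
  assumes "u \<noteq> u'"
  shows "grid u j k \<noteq> grid u' j k" "grid i u k \<noteq> grid i u' k" "grid i j u \<noteq> grid i j u'"
proof -
  have nz: "\<phi> (pure_tensor x y z) \<noteq> 0" if "x \<noteq> 0" "y \<noteq> 0" "z \<noteq> 0" for x y z
  proof -
    have "\<phi> (pure_tensor x y z) \<in> omega4"
      using that sub by (auto simp: segre_def)
    then show ?thesis
      by (auto simp: omega4_def component_def)
  qed
  have "nonzero_vec u + nonzero_vec u' \<noteq> 0"
    using assms inj_nonzero_vec by (simp add: bit_vec_add_eq_0_iff inj_eq)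
  note nz[OF this nonzero_vec_neq_0 nonzero_vec_neq_0] nz[OF nonzero_vec_neq_0 this nonzero_vec_neq_0]
    nz[OF nonzero_vec_neq_0 nonzero_vec_neq_0 this]
  then have "grid u j k + grid u' j k \<noteq> 0" "grid i u k + grid i u' k \<noteq> 0" "grid i j u + grid i j u' \<noteq> 0"
    by (simp_all add: grid_def \<phi>_add[symmetric] pure_tensor_add[symmetric])
  then show "grid u j k \<noteq> grid u' j k" "grid i u k \<noteq> grid i u' k" "grid i j u \<noteq> grid i j u'"
    by (simp_all add: bit_vec_add_eq_0_iff)
qed

lemma label_grid_inj:
  "inj (\<lambda>i. label (grid i j k) $ m)" "inj (\<lambda>j. label (grid i j k) $ m)" "inj (\<lambda>k. label (grid i j k) $ m)"
proof -
  show "inj (\<lambda>i. label (grid i j k) $ m)"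
    using grid_line(1)[of j k] label_generator grid_neq(1) unfolding inj_def by metis
  show "inj (\<lambda>j. label (grid i j k) $ m)"
    using grid_line(2)[of i k] label_generator grid_neq(2) unfolding inj_def by metis
  show "inj (\<lambda>k. label (grid i j k) $ m)"
    using grid_line(3)[of i j] label_generator grid_neq(3) unfolding inj_def by metis
qed

section \<open>The labels as affine functions on the grid\<close>

text \<open>Tensor products of unit vectors form a basis of the tensor space, so
  \<open>segre \<phi>\<close> spans; over the field with two elements an additive map is
  linear.\<close>

lemma segre_annihilator:
  assumes add: "\<And>u v. h (u + v) = h u + h v" and 0: "\<And>p. p \<in> segre \<phi> \<Longrightarrow> h p = (0 :: bit)"
  shows "h v = 0"
proof -
  have h0: "h 0 = 0"
    using add[of 0 0] by simp
  have axis: "\<phi> (axis n 1) \<in> segre \<phi>" for n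
  proof -
    obtain i j k where n: "n = (i, j, k)"
      by (metis prod_cases3)
    have "axis n 1 = pure_tensor (axis i 1) (axis j 1) (axis k 1)"
      by (auto simp: n pure_tensor_def vec_eq_iff axis_def)
    moreover have "axis i (1::bit) \<noteq> 0" "axis j (1::bit) \<noteq> 0" "axis k (1::bit) \<noteq> 0"
      by simp_all
    ultimately show ?thesis
      unfolding segre_def by (metis (mono_tags, lifting) mem_Collect_eq)
  qed
  obtain t where "v = \<phi> t"
    using iso by (metis linear_iso_def bij_pointE)
  also have "t = (\<Sum>n\<in>UNIV. t $ n *s axis n 1)"
    by (simp add: basis_expansion)
  finally have v: "v = (\<Sum>n\<in>UNIV. t $ n *s \<phi> (axis n 1))"
    by (simp add: module_hom.sum[OF module_hom_\<phi>] module_hom.scale[OF module_hom_\<phi>])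
  have "h (\<Sum>n\<in>A. t $ n *s \<phi> (axis n 1)) = 0" if "finite A" for A
    using that
  proof induction
    case (insert n A)
    then show ?case
      using 0[OF axis, of n] by (cases "t $ n") (auto simp: add h0)
  qed (simp add: h0)
  then show ?thesis
    by (simp add: v)
qed

text \<open>
  Such a relation between two labels would give a nonzero linear functional, involving only two
  of the planes \<open>V\<^sub>a, \<dots>, V\<^sub>d\<close>, that vanishes on the spanning set \<open>segre \<phi>\<close>.
\<close>

lemma coordinates_independent:
  assumes "m \<noteq> n" "y \<noteq> 0"
  shows "\<not> (\<forall>p\<in>segre \<phi>. label p $ n = x + y * label p $ m)"
proof
  assume *: "\<forall>p\<in>segre \<phi>. label p $ n = x + y * label p $ m"
  \<comment> \<open>A coordinate bit, as a function of the label, is a nonzero functional on the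
    plane. It vanishes at exactly one label, and the three nonzero functionals realise the three
    choices of that label.\<close>
  have "\<exists>\<alpha> \<beta>::bit. \<forall>l::3. (if x + y * l = 2 then 0 else 1) = \<alpha> * (if l = 2 then 0 else 1) + \<beta> * (if l = 1 then 0 else 1)"
    (is "\<exists>\<alpha> \<beta>. ?Q \<alpha> \<beta>")
  proof -
    have "?Q 1 0 \<or> ?Q 0 1 \<or> ?Q 1 1"
      using \<open>y \<noteq> 0\<close> unfolding all_3 by (cases x rule: cases_3; cases y rule: cases_3) simp_all
    then show ?thesis
      by blast
  qed
  then obtain \<alpha> \<beta> :: bit where \<alpha>\<beta>: "\<And>l::3. (if x + y * l = 2 then 0 else 1) = \<alpha> * (if l = 2 then 0 else 1) + \<beta> * (if l = 1 then 0 else 1)"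
    by blast
  define h where "h v = v $ P_index n + (\<alpha> * v $ P_index m + \<beta> * v $ Q_index m)" for v :: "bit ^ 8"
  have "h p = 0" if "p \<in> segre \<phi>" for p
  proof -
    have "h (point (label p)) = 0"
      unfolding h_def point_bits *[rule_format, OF that] \<alpha>\<beta> by simp
    then show ?thesis
      by (simp add: point_label_segre that)
  qed
  moreover have "h (u + v) = h u + h v" for u v
    by (simp only: h_def vector_add_component distrib_left ac_simps)
  \<comment> \<open>Since \<open>m \<noteq> n\<close>, only the first term of \<open>h\<close> sees
    this unit vector, and there \<open>h\<close> takes the value 1.\<close>
  ultimately have "h (axis (P_index n) 1) = 0"
    by (rule segre_annihilator[rotated])
  then show False
    using assms by (simp add: h_def axis_def)
qed

text \<open>Scaling the coefficient of \<open>i\<close> to 1 makes \<open>(b m, d m)\<close>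
  describe the linear part up to sign. Independence makes the four pairs distinct, so they exhaust
  the four sign pairs.\<close>

lemma label_grid_affine:
  "\<exists>c a b d. (\<forall>m. a m \<noteq> 0) \<and> bij_betw (\<lambda>m. (b m, d m)) UNIV ({1, 2} \<times> {1, 2}) \<and>
     (\<forall>i j k m. label (grid i j k) $ m = c m + a m * (i + b m * j + d m * k))"
proof -
  have "\<forall>m. \<exists>a b d. a \<noteq> 0 \<and> b \<noteq> 0 \<and> d \<noteq> 0 \<and>
      (\<forall>i j k. label (grid i j k) $ m = label (grid 0 0 0) $ m + a * i + b * j + d * k)"
    by (intro allI latin_cube_affine label_grid_inj)
  then obtain a b d where nz: "\<And>m. a m \<noteq> 0" "\<And>m. b m \<noteq> 0" "\<And>m. d m \<noteq> 0"
    and abd: "\<And>m i j k. label (grid i j k) $ m = label (grid 0 0 0) $ m + a m * i + b m * j + d m * k"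
    by metis
  define c b' d' where "c m = label (grid 0 0 0) $ m" and "b' m = a m * b m" and "d' m = a m * d m" for m
  have eq: "label (grid i j k) $ m = c m + a m * (i + b' m * j + d' m * k)" for i j k m
    unfolding abd[of i j k m] by (simp add: c_def b'_def d'_def algebra_simps nonzero_square_3 nz)
  have "inj (\<lambda>m. (b' m, d' m))"
  proof (rule injI, rule ccontr)
    fix m n assume *: "(b' m, d' m) = (b' n, d' n)" "m \<noteq> n"
    \<comment> \<open>With equal linear parts, solve the \<open>m\<close>-th label for the linear
      form, using that \<open>a m\<close> is its own inverse, and substitute into the
      \<open>n\<close>-th.\<close>
    have "label p $ n = (c n - a n * a m * c m) + (a n * a m) * label p $ m" if in_segre: "p \<in> segre \<phi>" for p
    proof -
      obtain i j k where p: "p = grid i j k"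
        using in_segre by (rule segre_cases)
      show ?thesis
        unfolding p eq using * by (simp add: algebra_simps nonzero_square_3 nz)
    qed
    moreover have "a n * a m \<noteq> 0"
      by (simp add: nonzero_3_mult_neq_0 nz)
    ultimately show False
      using coordinates_independent[OF *(2)] by blast
  qed
  moreover have "(\<lambda>m. (b' m, d' m)) ` UNIV \<subseteq> {1, 2} \<times> {1, 2}"
    unfolding b'_def d'_def using nonzero_3_mult_neq_0 nz nonzero_3_iff by blast
  ultimately have "bij_betw (\<lambda>m. (b' m, d' m)) UNIV ({1, 2} \<times> {1, 2})"
    unfolding bij_betw_def by (simp add: card_image card_subset_eq)
  then show ?thesis
    using nz(1) eq by blast
qed

end

section \<open>Planes over F_3, and the points of the four component lines\<close>

lemma two_planes_meet:
  fixes b d b' d' x y :: 3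
  assumes "b \<noteq> 0" "b' \<noteq> 0" "d \<noteq> 0" "d' \<noteq> 0" "(b, d) \<noteq> (b', d')"
  shows "\<exists>i j k. i + b * j + d * k = x \<and> i + b' * j + d' * k = y"
proof -
  have opposite: "v' = - v" if "v \<noteq> 0" "v' \<noteq> 0" "v \<noteq> v'" for v v' :: 3
    using that by (cases v rule: cases_3; cases v' rule: cases_3) simp_all
  \<comment> \<open>The solution of \<open>u + t = x\<close> and \<open>u - t = y\<close>, where
    halving is negation because \<open>2 = -1\<close>. The unequal coefficients are opposite and
    supply the two signs of \<open>t\<close>; the remaining variable is set to 0.\<close>
  have sol: "(- x - y) + (y - x) = x" "(- x - y) - (y - x) = y"
    by (cases x rule: cases_3; cases y rule: cases_3; simp)+
  show ?thesis
  proof (cases "b = b'")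
    case False
    have "(- x - y) + b * (b * (y - x)) + d * 0 = x" "(- x - y) + b' * (b * (y - x)) + d' * 0 = y"
      unfolding opposite[OF assms(1,2) False] by (simp_all only: nonzero_square_3[OF assms(1)] sol mult_minus_left mult_zero_right add_0_right add_uminus_conv_diff)
    then show ?thesis
      by blast
  next
    case True
    then have "d \<noteq> d'"
      using assms(5) by simp
    then have "(- x - y) + b * 0 + d * (d * (y - x)) = x" "(- x - y) + b' * 0 + d' * (d * (y - x)) = y"
      unfolding opposite[OF assms(3,4) \<open>d \<noteq> d'\<close>] by (simp_all only: nonzero_square_3[OF assms(3)] sol mult_minus_left mult_zero_right add_0_right add_uminus_conv_diff)
    then show ?thesis
      by blast
  qed
qed

text \<open>
  For two points of a fan, the terms on the left are up to sign the label differences read off from \<open>label_cell\<close> below.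
\<close>

lemma plane_direction:
  fixes b d s x :: 3
  assumes "b \<noteq> 0" "d \<noteq> 0"
  shows "(\<forall>\<beta> \<delta>. \<beta> \<noteq> 0 \<and> \<delta> \<noteq> 0 \<and> (\<beta>, \<delta>) \<noteq> (b, d) \<longrightarrow> (1 + \<beta> * b + \<delta> * d) * s + (\<delta> - d) * x \<noteq> 0)
    \<longleftrightarrow> s \<noteq> 0 \<and> x = 0"
  using assms unfolding all_3
  by (cases b rule: cases_3; simp; cases d rule: cases_3; simp; cases s rule: cases_3; cases x rule: cases_3; simp)

lemma hd_dist_eq_3_iff:
  assumes "label p $ m = label q $ m"
  shows "hd_dist p q = 3 \<longleftrightarrow> (\<forall>n. n \<noteq> m \<longrightarrow> label p $ n \<noteq> label q $ n)"
  using wt_Xi_eq_3_iff[of "label p - label q" m] assms by (simp add: hd_dist_def label_def)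

text \<open>The component in the \<open>m\<close>-th plane of every point whose \<open>m\<close>-th
  label is \<open>D\<close>.\<close>

definition coordinate_point :: "4 \<Rightarrow> 3 \<Rightarrow> bit ^ 8" where
  "coordinate_point m D =
     (if D = 2 then 0 else basis_vec (P_index m)) + (if D = 1 then 0 else basis_vec (Q_index m))"

lemma coordinate_point_bits:
  "coordinate_point m D $ P_index n = (if n = m \<and> D \<noteq> 2 then 1 else 0)"
  "coordinate_point m D $ Q_index n = (if n = m \<and> D \<noteq> 1 then 1 else 0)"
  by (simp_all add: coordinate_point_def basis_vec_def axis_def)

lemma range_coordinate_point:
  "range (coordinate_point m) = proj_points (vec.span {basis_vec (P_index m), basis_vec (Q_index m)})"
proof -
  let ?p = "basis_vec (P_index m)" and ?q = "basis_vec (Q_index m)"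
  have ex_bit: "(\<exists>k::bit. R k) \<longleftrightarrow> R 0 \<or> R 1" for R
    by (metis bit.exhaust)
  have "v \<in> vec.span {?p, ?q} \<longleftrightarrow> v \<in> {0, ?q, ?p, ?p + ?q}" for v
    by (simp add: vec.span_breakdown_eq ex_bit diff_eq_eq add.commute)
  then have "vec.span {?p, ?q} = {0, ?q, ?p, ?p + ?q}"
    by blast
  moreover have "?p \<noteq> 0" "?q \<noteq> 0" "?p + ?q \<noteq> 0"
    by (simp_all add: bit_vec_add_eq_0_iff basis_vec_def axis_eq_axis)
  ultimately have "proj_points (vec.span {?p, ?q}) = {?q, ?p, ?p + ?q}"
    by (simp add: proj_points_def insert_Diff_if)
  also have "\<dots> = {coordinate_point m 1, coordinate_point m 2, coordinate_point m 0}"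
    by (simp add: coordinate_point_def insert_commute)
  also have "\<dots> = range (coordinate_point m)"
    unfolding UNIV_3 by blast
  finally show ?thesis ..
qed

lemma range_coordinate_point_cases:
  "range (coordinate_point m) \<in> {proj_points V_a, proj_points V_b, proj_points V_c, proj_points V_d}"
  using exhaust_4[of m] unfolding range_coordinate_point V_a_def V_b_def V_c_def V_d_def
  by (auto simp: P_index_def Q_index_def insert_commute)

section \<open>Fans as level sets of the labels\<close>

locale omega4_segre_affine = omega4_segre +
  fixes c a b d :: "4 \<Rightarrow> 3"
  assumes a_nz: "a m \<noteq> 0"
    and bij_bd: "bij_betw (\<lambda>m. (b m, d m)) UNIV ({1, 2} \<times> {1, 2})"
    and label_grid: "label (grid i j k) $ m = c m + a m * (i + b m * j + d m * k)"
begin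

lemma b_nz: "b m \<noteq> 0" and d_nz: "d m \<noteq> 0"
  using bij_betw_apply[OF bij_bd, of m] by auto

lemma bd_eq_iff: "(b m, d m) = (b n, d n) \<longleftrightarrow> m = n"
  using bij_bd unfolding bij_betw_def inj_def by blast

lemma ex_bd:
  assumes "\<beta> \<noteq> 0" "\<delta> \<noteq> 0"
  obtains m where "b m = \<beta>" "d m = \<delta>"
proof -
  have "(\<beta>, \<delta>) \<in> (\<lambda>m. (b m, d m)) ` UNIV"
    using assms bij_betw_imp_surj_on[OF bij_bd] by (simp only: nonzero_3_iff mem_Times_iff fst_conv snd_conv)
  then show thesis
    using that by blast
qed

lemma grid_eq_iff: "grid i j k = grid i' j' k' \<longleftrightarrow> i = i' \<and> j = j' \<and> k = k'"
proof
  assume "grid i j k = grid i' j' k'"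
  then have "c m + a m * (i + b m * j + d m * k) = c m + a m * (i' + b m * j' + d m * k')" for m
    unfolding label_grid[symmetric] by simp
  then have "a m * (a m * (i + b m * j + d m * k)) = a m * (a m * (i' + b m * j' + d m * k'))" for m
    by simp
  then have "i + b m * j + d m * k = i' + b m * j' + d m * k'" for m
    by (simp only: nonzero_square_3[OF a_nz])
  then have 0: "(i - i') + b m * (j - j') + d m * (k - k') = 0" for m
    by (simp add: algebra_simps)
  \<comment> \<open>The four sign vectors span the dual of the index space, so only the zero
    difference is killed by all of them.\<close>
  have *: "u = 0 \<and> v = 0 \<and> w = 0" if "\<And>\<beta> \<delta>. \<beta> \<noteq> 0 \<Longrightarrow> \<delta> \<noteq> 0 \<Longrightarrow> u + \<beta> * v + \<delta> * w = 0" for u v w :: 3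
    using that[of 1 1] that[of 1 2] that[of 2 1] that[of 2 2]
    by (cases u rule: cases_3; cases v rule: cases_3; cases w rule: cases_3; simp)
  have "i - i' = 0 \<and> j - j' = 0 \<and> k - k' = 0"
    by (rule *) (metis ex_bd 0)
  then show "i = i' \<and> j = j' \<and> k = k'"
    by simp
qed simp

definition level :: "4 \<Rightarrow> 3 \<Rightarrow> (bit ^ 8) set" where
  "level m D = {p \<in> segre \<phi>. label p $ m = D}"

text \<open>
  Direction vectors \<open>(u, v, w)\<close> of the plane \<open>level m D\<close> satisfy \<open>u + b m * v + d m * w = 0\<close>. One of
  them is \<open>(1, b m, d m)\<close> itself, since \<open>1 + 1 + 1 = 0\<close>; it is the only one along which the
  three other labels all change, and \<open>s\<close> runs along it.
\<close>

definition cell :: "4 \<Rightarrow> 3 \<Rightarrow> 3 \<Rightarrow> 3 \<Rightarrow> bit ^ 8" where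
  "cell m D x s = grid (a m * (D - c m) + s - d m * x) (b m * s) (d m * s + x)"

lemma label_cell:
  "label (cell m D x s) $ n =
     c n + a n * (a m * (D - c m) + ((1 + b n * b m + d n * d m) * s + (d n - d m) * x))"
  by (simp add: cell_def label_grid algebra_simps)

lemma label_cell_self: "label (cell m D x s) $ m = D"
proof -
  have "b m * b m = 1" "d m * d m = 1"
    using nonzero_square_3 b_nz d_nz by blast+
  then have "label (cell m D x s) $ m = c m + a m * (a m * (D - c m))"
    by (simp add: label_cell)
  then show ?thesis
    by (simp add: nonzero_square_3[OF a_nz])
qed

lemma cell_eq_iff: "cell m D x s = cell m D x' s' \<longleftrightarrow> x = x' \<and> s = s'"
proof
  assume eq: "cell m D x s = cell m D x' s'"
  then have "b m * (b m * s) = b m * (b m * s')"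
    by (simp add: cell_def grid_eq_iff)
  then have "s = s'"
    by (simp only: nonzero_square_3[OF b_nz])
  with eq show "x = x' \<and> s = s'"
    by (simp add: cell_def grid_eq_iff)
qed simp

lemma level_eq: "level m D = {cell m D x s | x s. True}"
proof (intro equalityI subsetI)
  fix p assume p: "p \<in> level m D"
  then obtain i j k where ijk: "p = grid i j k"
    using segre_cases unfolding level_def by blast
  have "D = c m + a m * (i + b m * j + d m * k)"
    using p by (simp add: level_def ijk label_grid)
  then have "a m * (D - c m) = i + b m * j + d m * k"
    by (simp add: nonzero_square_3[OF a_nz])
  \<comment> \<open>Inverts \<open>cell\<close>: the second grid index is \<open>b m * s\<close>,
    which gives \<open>s\<close>, and the third then gives \<open>x\<close>.\<close>
  then have "p = cell m D (k - d m * (b m * j)) (b m * j)"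
    by (simp add: cell_def ijk grid_eq_iff algebra_simps nonzero_square_3[OF b_nz] nonzero_square_3[OF d_nz])
  then show "p \<in> {cell m D x s | x s. True}"
    by blast
qed (auto simp: level_def label_cell_self, simp add: cell_def)

lemma card_level: "card (level m D) = 9"
proof -
  have "level m D = (\<lambda>(x, s). cell m D x s) ` UNIV"
    by (auto simp: level_eq)
  moreover have "inj (\<lambda>(x, s). cell m D x s)"
    by (auto simp: inj_def cell_eq_iff)
  ultimately show ?thesis
    by (simp add: card_image)
qed

lemma card_segre: "card (segre \<phi>) = 27"
proof -
  have "segre \<phi> = (\<lambda>(i, j, k). grid i j k) ` UNIV"
    by (simp add: segre_eq set_eq_iff image_iff)
  moreover have "inj (\<lambda>(i, j, k). grid i j k)"
    by (auto simp: inj_def grid_eq_iff)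
  ultimately show ?thesis
    by (simp add: card_image)
qed

lemma fan_level: "fan \<phi> (level m D)"
  unfolding fan_def
proof (intro conjI ballI impI notI)
  show "level m D \<subseteq> segre \<phi>"
    by (auto simp: level_def)
  fix p q assume "p \<in> level m D" "q \<in> level m D" "p \<noteq> q" "\<exists>l\<in>generators \<phi>. p \<in> l \<and> q \<in> l"
  then show False
    using label_generator unfolding level_def by blast
qed (rule card_level)

text \<open>Each pair \<open>(i, j)\<close> carries at most one point of the fan. Nine points fill
  all nine pairs, so the fan is the graph of a function, and the other two families of generators
  make it a Latin square.\<close>

lemma fan_imp_level:
  assumes "fan \<phi> F"
  shows "\<exists>m D. F = level m D"
proof -
  have F: "F \<subseteq> segre \<phi>" "card F = 9"
    and line: "\<And>p q l. p \<in> F \<Longrightarrow> q \<in> F \<Longrightarrow> l \<in> generators \<phi> \<Longrightarrow> p \<in> l \<Longrightarrow> q \<in> l \<Longrightarrow> p = q"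
    using assms unfolding fan_def by blast+
  have line1: "i = i'" if "grid i j k \<in> F" "grid i' j k \<in> F" for i i' j k
    using grid_line(1)[of j k] line that grid_neq(1) by metis
  have line2: "j = j'" if "grid i j k \<in> F" "grid i j' k \<in> F" for i j j' k
    using grid_line(2)[of i k] line that grid_neq(2) by metis
  have line3: "k = k'" if "grid i j k \<in> F" "grid i j k' \<in> F" for i j k k'
    using grid_line(3)[of i j] line that grid_neq(3) by metis
  define G where "G = {(i, j, k). grid i j k \<in> F}"
  have "(\<lambda>(i, j, k). grid i j k) ` G = F"
  proof (intro equalityI subsetI)
    fix p assume p: "p \<in> F"
    then obtain i j k where "p = grid i j k"
      using F(1) segre_cases by blast
    with p show "p \<in> (\<lambda>(i, j, k). grid i j k) ` G"
      by (intro image_eqI[of _ _ "(i, j, k)"]) (simp_all add: G_def)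
  qed (auto simp: G_def)
  moreover have "inj_on (\<lambda>(i, j, k). grid i j k) G"
    by (auto simp: inj_on_def grid_eq_iff)
  ultimately have "card G = 9"
    using F(2) card_image by metis
  moreover have "inj_on (\<lambda>(i, j, k). (i, j)) G"
    using line3 by (auto simp: inj_on_def G_def)
  ultimately have "card ((\<lambda>(i, j, k). (i, j)) ` G) = 9"
    by (simp add: card_image)
  then have "(\<lambda>(i, j, k). (i, j)) ` G = UNIV"
    by (intro card_subset_eq) simp_all
  then have "\<exists>k. grid i j k \<in> F" for i j
    unfolding G_def by (auto simp: set_eq_iff image_iff)
  then obtain g where g: "\<And>i j. grid i j (g i j) \<in> F"
    by metis
  have "inj (\<lambda>i. g i j)" for j
    using line1 g unfolding inj_def by metis
  moreover have "inj (g i)" for i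
    using line2 g unfolding inj_def by metis
  ultimately obtain A B where AB: "A \<noteq> 0" "B \<noteq> 0" "\<And>i j. g i j = g 0 0 + A * i + B * j"
    using latin_square_affine[of g] by metis
  have "- A \<noteq> 0"
    using AB(1) by simp
  \<comment> \<open>Multiplying \<open>k = g 0 0 + A * i + B * j\<close> by \<open>A\<close> gives
    \<open>i + A * B * j - A * k = - A * g 0 0\<close>, from which \<open>m\<close> and
    \<open>D\<close> are read off.\<close>
  then obtain m where m: "b m = A * B" "d m = - A"
    using ex_bd nonzero_3_mult_neq_0[OF AB(1,2)] by metis
  define D where "D = c m - a m * (A * g 0 0)"
  have "F \<subseteq> level m D"
  proof
    fix p assume p: "p \<in> F"
    then obtain i j k where ijk: "p = grid i j k"
      using F(1) segre_cases by blast
    then have "k = g i j"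
      using p g line3 by blast
    then have "k = g 0 0 + A * i + B * j"
      by (simp only: AB(3)[of i j])
    then have "label p $ m = D"
      by (simp add: ijk label_grid m D_def algebra_simps nonzero_square_3[OF AB(1)])
    then show "p \<in> level m D"
      using p F(1) by (auto simp: level_def)
  qed
  then have "F = level m D"
    using F(2) card_level by (intro card_subset_eq) (simp_all add: card_ge_0_finite)
  then show ?thesis
    by blast
qed

lemma level_inter:
  assumes "m \<noteq> n"
  shows "level m D \<inter> level n E \<noteq> {}"
proof -
  have "(b m, d m) \<noteq> (b n, d n)"
    using assms bd_eq_iff by blast
  then obtain i j k where "i + b m * j + d m * k = a m * (D - c m)" "i + b n * j + d n * k = a n * (E - c n)"
    using two_planes_meet b_nz d_nz by blast
  then have "label (grid i j k) $ m = D" "label (grid i j k) $ n = E"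
    by (simp_all add: label_grid nonzero_square_3[OF a_nz])
  then have "grid i j k \<in> level m D \<inter> level n E"
    by (simp add: level_def)
  then show ?thesis
    by blast
qed

section \<open>The troikas in a fan\<close>

lemma hd_dist_cell:
  "hd_dist (cell m D x s) (cell m D x' s') = 3 \<longleftrightarrow> s \<noteq> s' \<and> x = x'"
proof -
  let ?e = "\<lambda>\<beta> \<delta>. (1 + \<beta> * b m + \<delta> * d m) * (s - s') + (\<delta> - d m) * (x - x')"
  have *: "label (cell m D x s) $ n = label (cell m D x' s') $ n \<longleftrightarrow> ?e (b n) (d n) = 0" for n
  proof -
    have "label (cell m D x s) $ n - label (cell m D x' s') $ n = a n * ?e (b n) (d n)"
      by (simp add: label_cell algebra_simps)
    then show ?thesis
      using nonzero_3_mult_neq_0[OF a_nz] by (metis eq_iff_diff_eq_0 mult_zero_right)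
  qed
  have "hd_dist (cell m D x s) (cell m D x' s') = 3 \<longleftrightarrow> (\<forall>n. n \<noteq> m \<longrightarrow> ?e (b n) (d n) \<noteq> 0)"
    unfolding *[symmetric] by (rule hd_dist_eq_3_iff) (simp add: label_cell_self)
  \<comment> \<open>As \<open>n\<close> runs over the other labels, \<open>(b n, d n)\<close> runs
    over all sign pairs except \<open>(b m, d m)\<close>.\<close>
  also have "\<dots> \<longleftrightarrow> (\<forall>\<beta> \<delta>. \<beta> \<noteq> 0 \<and> \<delta> \<noteq> 0 \<and> (\<beta>, \<delta>) \<noteq> (b m, d m) \<longrightarrow> ?e \<beta> \<delta> \<noteq> 0)"
  proof (intro iffI allI impI)
    fix \<beta> \<delta>
    assume n: "\<forall>n. n \<noteq> m \<longrightarrow> ?e (b n) (d n) \<noteq> 0" and "\<beta> \<noteq> 0 \<and> \<delta> \<noteq> 0 \<and> (\<beta>, \<delta>) \<noteq> (b m, d m)"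
    moreover from this obtain k where "b k = \<beta>" "d k = \<delta>"
      using ex_bd by blast
    ultimately show "?e \<beta> \<delta> \<noteq> 0"
      using n[rule_format, of k] by auto
  next
    fix n
    assume e: "\<forall>\<beta> \<delta>. \<beta> \<noteq> 0 \<and> \<delta> \<noteq> 0 \<and> (\<beta>, \<delta>) \<noteq> (b m, d m) \<longrightarrow> ?e \<beta> \<delta> \<noteq> 0" and "n \<noteq> m"
    then have "(b n, d n) \<noteq> (b m, d m)"
      using bd_eq_iff by blast
    then show "?e (b n) (d n) \<noteq> 0"
      using e[rule_format, of "b n" "d n"] b_nz d_nz by blast
  qed
  also have "\<dots> \<longleftrightarrow> s - s' \<noteq> 0 \<and> x - x' = 0"
    by (rule plane_direction[OF b_nz d_nz])
  finally show ?thesis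
    by simp
qed

definition block :: "4 \<Rightarrow> 3 \<Rightarrow> 3 \<Rightarrow> (bit ^ 8) set" where
  "block m D x = range (cell m D x)"

lemma card_block: "card (block m D x) = 3"
  unfolding block_def by (simp add: card_image inj_def cell_eq_iff)

lemma Union_block: "\<Union> (range (block m D)) = level m D"
  by (auto simp: block_def level_eq)

lemma card_range_block: "card (range (block m D)) = 3"
proof -
  have "inj (block m D)"
  proof (rule injI)
    fix x y assume "block m D x = block m D y"
    then have "cell m D x 0 \<in> block m D y"
      unfolding block_def by blast
    then show "x = y"
      by (auto simp: block_def cell_eq_iff)
  qed
  then show ?thesis
    by (simp add: card_image)
qed

lemma troika_block: "troika (segre \<phi>) (block m D x)"
proof -
  have "block m D x \<subseteq> segre \<phi>"
    using Union_block unfolding level_def by blast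
  moreover have "\<forall>p\<in>block m D x. \<forall>q\<in>block m D x. p \<noteq> q \<longrightarrow> hd_dist p q = 3"
    by (auto simp: block_def hd_dist_cell cell_eq_iff)
  ultimately show ?thesis
    by (simp add: troika_def card_block)
qed

text \<open>Distance 3 forces all points of the troika to share the parameter \<open>x\<close> of
  one of them, and three points fill the block.\<close>

lemma troika_in_level:
  assumes "troika (segre \<phi>) t" "t \<subseteq> level m D"
  shows "\<exists>x. t = block m D x"
proof -
  have t: "card t = 3" "\<And>p q. p \<in> t \<Longrightarrow> q \<in> t \<Longrightarrow> p \<noteq> q \<Longrightarrow> hd_dist p q = 3"
    using assms(1) unfolding troika_def by blast+
  then obtain p where p: "p \<in> t"
    by fastforce
  then obtain x s where xs: "p = cell m D x s"
    using assms(2) level_eq by blast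
  have "t \<subseteq> block m D x"
  proof
    fix q assume q: "q \<in> t"
    then obtain x' s' where q': "q = cell m D x' s'"
      using assms(2) level_eq by blast
    have "x = x'"
      using t(2)[OF p q] by (cases "p = q") (auto simp: xs q' hd_dist_cell cell_eq_iff)
    then show "q \<in> block m D x"
      by (simp add: q' block_def)
  qed
  then have "t = block m D x"
    using t(1) card_block by (intro card_subset_eq) (simp_all add: block_def)
  then show ?thesis
    by blast
qed

text \<open>The members of a triplet lie in the fan they cover, so they are blocks; there are only
  three blocks.\<close>

lemma troika_triplet_level_iff:
  "troika_triplet (segre \<phi>) (level m D) P \<longleftrightarrow> P = range (block m D)"
proof
  assume P: "troika_triplet (segre \<phi>) (level m D) P"
  have "t \<in> range (block m D)" if "t \<in> P" for t
  proof -
    have "troika (segre \<phi>) t" "t \<subseteq> level m D"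
      using P that by (auto simp: troika_triplet_def)
    then show ?thesis
      using troika_in_level by blast
  qed
  then have "P \<subseteq> range (block m D)"
    by blast
  then show "P = range (block m D)"
    using P card_range_block unfolding troika_triplet_def by (intro card_subset_eq) simp_all
next
  assume "P = range (block m D)"
  then show "troika_triplet (segre \<phi>) (level m D) P"
    using card_range_block troika_block Union_block by (auto simp: troika_triplet_def)
qed

section \<open>Centres of troikas and fans\<close>

lemma centre_block: "centre (block m D x) = coordinate_point m D"
proof -
  define p where "p = cell m D x"
  have inj: "inj p"
    by (simp add: inj_def p_def cell_eq_iff)
  have "block m D x = {p 0, p 1, p 2}"
    by (simp add: block_def p_def UNIV_3)
  then have "centre (block m D x) = p 0 + p 1 + p 2"
    by (simp add: centre_def inj_eq[OF inj] add.assoc)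
  also have "\<dots> = point (label (p 0)) + point (label (p 1)) + point (label (p 2))"
    by (simp add: point_label_segre p_def cell_def)
  also have "\<dots> = coordinate_point m D" (is "?v = _")
  proof -
    have self: "label (p s) $ m = D" for s
      by (simp add: p_def label_cell_self)
    \<comment> \<open>Mutual distance 3 makes the labels other than the \<open>m\<close>-th run
      through all of F_3, so these components cancel. Three equal components in the
      \<open>m\<close>-th plane leave one copy.\<close>
    have other: "label (p s) $ n \<noteq> label (p s') $ n" if "s \<noteq> s'" "n \<noteq> m" for s s' n
      using hd_dist_cell[of m D x s x s'] hd_dist_eq_3_iff[of "p s" m "p s'"] that by (simp add: p_def label_cell_self)
    have "?v $ P_index n = coordinate_point m D $ P_index n \<and> ?v $ Q_index n = coordinate_point m D $ Q_index n" for n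
    proof (cases "n = m")
      case True
      then show ?thesis
        by (simp add: point_bits self coordinate_point_bits)
    next
      case False
      then show ?thesis
        using other[of 0 1 n] other[of 0 2 n] other[of 1 2 n]
        by (simp add: sum_points_coordinate coordinate_point_bits del: vector_add_component)
    qed
    then show ?thesis
      unfolding vec_eq_iff by (metis index_cases)
  qed
  finally show ?thesis .
qed

lemma fan_centre_level: "fan_centre (segre \<phi>) (level m D) = coordinate_point m D"
  unfolding fan_centre_def troika_triplet_level_iff
  by (rule the_equality) (auto simp: centre_block)

section \<open>Triplets of fans\<close>

lemma level_neq: "D \<noteq> E \<Longrightarrow> level m D \<noteq> level m E"
  using card_level[of m D] unfolding level_def by (metis (mono_tags, lifting) card.empty empty_Collect_eq mem_Collect_eq zero_neq_numeral)

lemma fan_triplet_range_level: "fan_triplet \<phi> (range (level m))"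
proof -
  have "inj (level m)"
    using level_neq by (metis injI)
  then show ?thesis
    using fan_level by (auto simp: fan_triplet_def card_image) (auto simp: level_def)
qed

text \<open>Three sets of nine points can cover 27 points only if no two of them overlap.\<close>

lemma fan_triplet_disjoint:
  assumes "fan_triplet \<phi> T" "F \<in> T" "F' \<in> T" "F \<noteq> F'"
  shows "F \<inter> F' = {}"
proof -
  have T: "card T = 3" "\<And>F. F \<in> T \<Longrightarrow> card F = 9" "\<Union>T = segre \<phi>"
    using assms(1) by (simp_all add: fan_triplet_def fan_def)
  have fin: "finite F" if "F \<in> T" for F
    using T(2)[OF that] by (simp add: card_ge_0_finite)
  have "finite T"
    using T(1) by (simp add: card_ge_0_finite)
  have "card (T - {F, F'}) = 1"
    using T(1) assms(2-4) by (simp add: card_Diff_subset)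
  then obtain F'' where "T - {F, F'} = {F''}"
    by (auto simp: card_1_singleton_iff)
  then have F'': "T = {F, F', F''}" "F'' \<in> T"
    using assms(2,3) by blast+
  have "\<Union>T = F \<union> F' \<union> F''"
    by (subst F''(1)) blast
  then have "27 = card (F \<union> F' \<union> F'')"
    using card_segre T(3) by simp
  also have "\<dots> \<le> card (F \<union> F') + card F''"
    by (rule card_Un_le)
  finally have "18 \<le> card (F \<union> F')"
    using T(2) F''(2) by simp
  moreover have "card F + card F' = card (F \<union> F') + card (F \<inter> F')"
    using fin assms by (intro card_Un_Int) auto
  ultimately have "card (F \<inter> F') = 0"
    using T(2) assms by simp
  then show ?thesis
    using fin assms by simp
qed

text \<open>A level set of any other label would meet \<open>level m D\<close>, against
  disjointness, so only the three level sets of the \<open>m\<close>-th label can occur.\<close>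

lemma fan_triplet_level_iff: "fan_triplet \<phi> T \<and> level m D \<in> T \<longleftrightarrow> T = range (level m)"
proof
  assume T: "fan_triplet \<phi> T \<and> level m D \<in> T"
  have "F \<in> range (level m)" if F: "F \<in> T" for F
  proof (cases "F = level m D")
    case False
    obtain n E where "F = level n E"
      using T F fan_imp_level unfolding fan_triplet_def by blast
    moreover have "F \<inter> level m D = {}"
      using T F False by (intro fan_triplet_disjoint[of T]) simp_all
    ultimately have "n = m"
      using level_inter[of n m E D] by blast
    then show ?thesis
      by (simp add: \<open>F = level n E\<close>)
  qed simp
  then have "T \<subseteq> range (level m)"
    by blast
  then show "T = range (level m)"
    using T fan_triplet_range_level unfolding fan_triplet_def by (intro card_subset_eq) simp_all
qed (use fan_triplet_range_level in auto)

lemma centre_set_range_level: "centre_set (segre \<phi>) (range (level m)) = range (coordinate_point m)"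
  by (simp add: centre_set_def image_image fan_centre_level)

end

theorem theorem10:
  fixes \<phi> :: "tensor3 \<Rightarrow> bit ^ 8" and F :: "(bit ^ 8) set"
  assumes "linear_iso \<phi>" and "segre \<phi> \<subseteq> omega4" and "fan \<phi> F"
  shows "(\<exists>!P. troika_triplet (segre \<phi>) F P) \<and>
         (\<forall>P. troika_triplet (segre \<phi>) F P \<longrightarrow> (\<exists>c. \<forall>t\<in>P. centre t = c)) \<and>
         (\<exists>!T. fan_triplet \<phi> T \<and> F \<in> T) \<and>
         (\<forall>T. fan_triplet \<phi> T \<and> F \<in> T \<longrightarrow>
            centre_set (segre \<phi>) T \<in> {proj_points V_a, proj_points V_b, proj_points V_c, proj_points V_d})"
proof -
  interpret omega4_segre \<phi>
    using assms(1,2) by unfold_locales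
  obtain c a b d where "omega4_segre_affine \<phi> c a b d"
    using label_grid_affine omega4_segre_axioms
    unfolding omega4_segre_affine_def omega4_segre_affine_axioms_def by blast
  then interpret omega4_segre_affine \<phi> c a b d .
  obtain m D where F: "F = level m D"
    using fan_imp_level[OF assms(3)] by blast
  have "\<exists>c. \<forall>t\<in>range (block m D). centre t = c"
    by (auto simp: centre_block)
  then show ?thesis
    \<comment> \<open>Both characterisations are equations, so existence and uniqueness hold at
      once.\<close>
    unfolding F troika_triplet_level_iff fan_triplet_level_iff
    using range_coordinate_point_cases centre_set_range_level by simp
qed

end
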